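(* Let $k$ be a fixed constant and let $T=(V,E)$ be a tree with $n$ vertices and maximum degree at most $k$. Let the evolver be random (each evolver step swaps the labels of the two endpoints of an edge of $T$ chosen uniformly at random). Then for any speedup factor $c \geq 1$ and any algorithm $\mathcal{A}$ in the class $\mathcal{C}$, for all sufficiently large times $t$ we have $D(\mathcal{T},\mathcal{H})_{(t)} = \Omega(n)$ with high probability.
   Context: Setting (evolving label tracking on a tree): $T=(V,E)$ is a fixed tree with $n$ vertices and maximum degree $k$. A set of $n$ distinct labels $L=\{l_1,\dots,l_n\}$ is placed on the vertices by a bijection $M_T: L\to V$ (the true labeling $\mathcal{T}=(T,M_T)$). An evolver repeatedly changes $M_T$; each evolver step selects an edge $(u,v)$ of $T$ and swaps the labels at $u$ and $v$. An algorithm maintains a hypothesis $\mathcal{H}=(T,M_H)$ where $M_H: L\to V$ is an arbitrary (not necessarily injective) map. An oracle $\mathcal{O}$, given a label $l$ and a vertex $u$, returns null if $M_T(l)=u$ and otherwise returns the edge incident to $u$ on the path from $u$ to $M_T(l)$. The class $\mathcal{C}$ consists of algorithms each of whose steps selects a label $l$ and a vertex $u$, queries $\mathcal{O}(l,u)$, and may then move $l$ from $M_H(l)$ to an adjacent vertex of $T$. With speedup factor $c\ge 1$, the algorithm performs one step per time unit and the evolver performs one swap every $c$ time units. The distance is $D(\mathcal{T},\mathcal{H})=\sum_{l\in L} d_T(M_T(l),M_H(l))$, where $d_T$ is the number of edges on the tree path; $D(\mathcal{T},\mathcal{H})_{(t)}$ denotes its value at time $t$. "With high probability" means with probability $1-o(1)$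 as $n\to\infty$ (here in fact $1-e^{-\Omega(n)}$ is the intended strength). *)

theory Defs
  imports "HOL-Probability.Probability" "HOL-Combinatorics.Transposition"
begin

(* A simple graph is a vertex set V together with a set E of two-element subsets of V. *)

definition simple_graph :: "'v set \<Rightarrow> 'v set set \<Rightarrow> bool" where
  "simple_graph V E \<longleftrightarrow> finite V \<and> (\<forall>e\<in>E. e \<subseteq> V \<and> card e = 2)"

definition is_path :: "'v set \<Rightarrow> 'v set set \<Rightarrow> 'v \<Rightarrow> 'v list \<Rightarrow> 'v \<Rightarrow> bool" where
  "is_path V E u p v \<longleftrightarrow>
     p \<noteq> [] \<and> hd p = u \<and> last p = v \<and> distinct p \<and> set p \<subseteq> V \<and>
     successively (\<lambda>x y. {x, y} \<in> E) p"

definition is_cycle :: "'v set \<Rightarrow> 'v set set \<Rightarrow> 'v list \<Rightarrow> bool" where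
  "is_cycle V E p \<longleftrightarrow>
     length p \<ge> 3 \<and> distinct p \<and> set p \<subseteq> V \<and>
     successively (\<lambda>x y. {x, y} \<in> E) p \<and> {last p, hd p} \<in> E"

definition is_tree :: "'v set \<Rightarrow> 'v set set \<Rightarrow> bool" where
  "is_tree V E \<longleftrightarrow>
     simple_graph V E \<and> V \<noteq> {} \<and>
     (\<forall>u\<in>V. \<forall>v\<in>V. \<exists>p. is_path V E u p v) \<and>
     \<not> (\<exists>p. is_cycle V E p)"

definition vertex_degree :: "'v set set \<Rightarrow> 'v \<Rightarrow> nat" where
  "vertex_degree E v = card {e \<in> E. v \<in> e}"

definition tree_path :: "'v set \<Rightarrow> 'v set set \<Rightarrow> 'v \<Rightarrow> 'v \<Rightarrow> 'v list" where
  "tree_path V E u v = (THE p. is_path V E u p v)"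

definition tree_dist :: "'v set \<Rightarrow> 'v set set \<Rightarrow> 'v \<Rightarrow> 'v \<Rightarrow> nat" where
  "tree_dist V E u v = length (tree_path V E u v) - 1"

definition labeling_dist ::
  "'v set \<Rightarrow> 'v set set \<Rightarrow> 'l set \<Rightarrow> ('l \<Rightarrow> 'v) \<Rightarrow> ('l \<Rightarrow> 'v) \<Rightarrow> nat" where
  "labeling_dist V E L MT MH = (\<Sum>l\<in>L. tree_dist V E (MT l) (MH l))"

definition swap_along :: "'v set \<Rightarrow> ('l \<Rightarrow> 'v) \<Rightarrow> 'l \<Rightarrow> 'v" where
  "swap_along e M = (\<lambda>l. if M l \<in> e then (THE w. e = {M l, w}) else M l)"

lemma swap_along_doubleton:
  assumes "u \<noteq> v"
  shows "swap_along {u, v} M = Transposition.transpose u v \<circ> M"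
proof
  fix l
  have u: "(THE w. {u, v} = {u, w}) = v" and v: "(THE w. {u, v} = {v, w}) = u"
    using assms by (auto intro!: the_equality simp: doubleton_eq_iff)
  show "swap_along {u, v} M l = (Transposition.transpose u v \<circ> M) l"
    using u v by (auto simp: swap_along_def Transposition.transpose_def)
qed

(* None is the null answer; otherwise the answer is the first edge of the path from u
   to the true position of l. *)

definition path_oracle :: "'v set \<Rightarrow> 'v set set \<Rightarrow> ('l \<Rightarrow> 'v) \<Rightarrow> 'l \<Rightarrow> 'v \<Rightarrow> 'v set option" where
  "path_oracle V E MT l u =
     (if MT l = u then None else Some {u, tree_path V E u (MT l) ! 1})"

(* Everything the algorithm has seen and done, most recent step first. An entry records the
   queried label and vertex, the oracle's answer, and the vertex to which the label was moved
   (None if it stayed). *)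

type_synonym ('l, 'v) history = "('l \<times> 'v \<times> 'v set option \<times> 'v option) list"

(* An adaptive, possibly randomized algorithm. Both decisions may depend on the history and
   on the current hypothesis map, but on the true labeling only through oracle answers. *)

record ('l, 'v) algorithm =
  choose_query :: "('l, 'v) history \<Rightarrow> ('l \<Rightarrow> 'v) \<Rightarrow> ('l \<times> 'v) pmf"
  choose_move ::
    "('l, 'v) history \<Rightarrow> ('l \<Rightarrow> 'v) \<Rightarrow> 'l \<Rightarrow> 'v \<Rightarrow> 'v set option \<Rightarrow> 'v option pmf"

definition class_C :: "'v set \<Rightarrow> 'v set set \<Rightarrow> 'l set \<Rightarrow> ('l, 'v) algorithm set" where
  "class_C V E L = {A.
     (\<forall>h MH. MH ` L \<subseteq> V \<longrightarrow>
        set_pmf (choose_query A h MH) \<subseteq> L \<times> V \<and>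
        (\<forall>l\<in>L. \<forall>u\<in>V. \<forall>a v.
           Some v \<in> set_pmf (choose_move A h MH l u a) \<longrightarrow> {MH l, v} \<in> E))}"

(* The j-th swap happens at time j * c, so floor (t / c) swaps have happened by time t.
   For c \<ge> 1 at most one swap falls into each interval (t, t + 1]. *)

definition swap_due :: "real \<Rightarrow> nat \<Rightarrow> bool" where
  "swap_due c t \<longleftrightarrow> \<lfloor>real t / c\<rfloor> < \<lfloor>real (Suc t) / c\<rfloor>"

type_synonym ('l, 'v) state = "('l \<Rightarrow> 'v) \<times> ('l \<Rightarrow> 'v) \<times> ('l, 'v) history"

definition evolver_step ::
  "'v set set \<Rightarrow> real \<Rightarrow> nat \<Rightarrow> ('l \<Rightarrow> 'v) \<Rightarrow> ('l \<Rightarrow> 'v) pmf" where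
  "evolver_step E c t MT =
     (if swap_due c t then map_pmf (\<lambda>e. swap_along e MT) (pmf_of_set E) else return_pmf MT)"

definition algorithm_step ::
  "'v set \<Rightarrow> 'v set set \<Rightarrow> ('l, 'v) algorithm \<Rightarrow> ('l, 'v) state \<Rightarrow> ('l, 'v) state pmf" where
  "algorithm_step V E A = (\<lambda>(MT, MH, h).
     bind_pmf (choose_query A h MH) (\<lambda>(l, u).
     let a = path_oracle V E MT l u in
     map_pmf (\<lambda>m. (MT, (case m of None \<Rightarrow> MH | Some v \<Rightarrow> MH(l := v)), (l, u, a, m) # h))
       (choose_move A h MH l u a)))"

(* Time unit from t to t + 1: the evolver's swap, if due, precedes the algorithm's step. *)

definition time_step ::
  "'v set \<Rightarrow> 'v set set \<Rightarrow> real \<Rightarrow> ('l, 'v) algorithm \<Rightarrow> nat \<Rightarrow>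
     ('l, 'v) state \<Rightarrow> ('l, 'v) state pmf" where
  "time_step V E c A t = (\<lambda>(MT, MH, h).
     bind_pmf (evolver_step E c t MT) (\<lambda>MT'. algorithm_step V E A (MT', MH, h)))"

primrec run ::
  "'v set \<Rightarrow> 'v set set \<Rightarrow> real \<Rightarrow> ('l, 'v) algorithm \<Rightarrow> ('l \<Rightarrow> 'v) \<Rightarrow> ('l \<Rightarrow> 'v) \<Rightarrow> nat \<Rightarrow>
     ('l, 'v) state pmf" where
  "run V E c A MT0 MH0 0 = return_pmf (MT0, MH0, [])"
| "run V E c A MT0 MH0 (Suc t) = bind_pmf (run V E c A MT0 MH0 t) (time_step V E c A t)"

definition distance_at ::
  "'v set \<Rightarrow> 'v set set \<Rightarrow> 'l set \<Rightarrow> real \<Rightarrow> ('l, 'v) algorithm \<Rightarrow> ('l \<Rightarrow> 'v) \<Rightarrow> ('l \<Rightarrow> 'v) \<Rightarrow>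
     nat \<Rightarrow> nat pmf" where
  "distance_at V E L c A MT0 MH0 t =
     map_pmf (\<lambda>(MT, MH, h). labeling_dist V E L MT MH) (run V E c A MT0 MH0 t)"

end

theory Submission
  imports Defs
begin

text \<open>
  Only the last \<open>W = w n\<close> time steps matter, for a small constant \<open>w\<close>, and the proof is an entropy
  count. Each oracle answer takes at most \<open>k + 1\<close> values, so guessing all answers in the window
  costs a factor \<open>(k + 1)\<^sup>W\<close> and makes the final hypothesis independent of the \<open>m \<approx> W / c\<close> swaps of
  the window. A fixed hypothesis is within distance \<open>\<alpha> n\<close> of only exponentially few labelings
  \<open>x\<^bsup>-\<alpha> n\<^esup> (1 - k x)\<^bsup>-n\<^esup>\<close>, with arbitrarily small rate. Finally, \<open>m\<close> random swaps produce any given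
  labeling with probability at most \<open>(2 y)\<^sup>m\<close>, where \<open>y\<close> tends to \<open>0\<close> with \<open>m / n\<close>; so for small
  \<open>w\<close> the unpredictability of a single swap outweighs all answers received between two swaps.
\<close>

section \<open>Uniqueness of simple paths in acyclic graphs\<close>

lemma is_path_Cons:
  "p \<noteq> [] \<Longrightarrow> is_path V E u (x # p) v \<longleftrightarrow>
     x = u \<and> u \<in> V \<and> u \<notin> set p \<and> {u, hd p} \<in> E \<and> is_path V E (hd p) p v"
  by (cases p) (auto simp: is_path_def)

lemma is_path_refl: "is_path V E u p u \<Longrightarrow> p = [u]"
  by (cases p) (auto simp: is_path_def split: if_splits)

text \<open>Induction peels off the common first vertex \<open>u\<close>. If the second vertices
  differ, a cycle arises: from \<open>u\<close> along \<open>p\<close> to the first vertex shared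
  with \<open>q'\<close>, and back along \<open>q'\<close> to \<open>u\<close>.\<close>

lemma is_path_unique:
  assumes acyc: "\<not> (\<exists>p. is_cycle V E p)"
  assumes "is_path V E u p v" "is_path V E u q v"
  shows "p = q"
  using assms(2,3)
proof (induction p arbitrary: u q)
  case Nil
  then show ?case by (simp add: is_path_def)
next
  case (Cons a p)
  then have a: "a = u" by (simp add: is_path_def)
  show ?case
  proof (cases "u = v")
    case True
    then show ?thesis using Cons.prems is_path_refl by metis
  next
    case False
    have pne: "p \<noteq> []" using Cons.prems(1) False by (auto simp: is_path_def)
    obtain q' where q: "q = u # q'" using Cons.prems(2) by (cases q) (auto simp: is_path_def)
    have qne: "q' \<noteq> []" using Cons.prems(2) False q by (auto simp: is_path_def)
    have p1: "u \<in> V" "u \<notin> set p" "{u, hd p} \<in> E" "is_path V E (hd p) p v"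
      using Cons.prems(1) is_path_Cons[OF pne] by auto
    have q1: "u \<notin> set q'" "{u, hd q'} \<in> E" "is_path V E (hd q') q' v"
      using Cons.prems(2) is_path_Cons[OF qne] q by auto
    show ?thesis
    proof (cases "hd p = hd q'")
      case True
      then show ?thesis using Cons.IH p1(4) q1(3) a q by metis
    next
      case hd_ne: False
      have "v \<in> set p" "v \<in> set q'"
        using p1(4) q1(3) last_in_set[OF pne] last_in_set[OF qne] by (auto simp: is_path_def)
      \<comment> \<open>Taking the first shared vertex keeps \<open>xs\<close> off
        \<open>q'\<close>, which is what makes \<open>r\<close> distinct.\<close>
      then obtain xs x ys where pd: "p = xs @ x # ys" and xq: "x \<in> set q'"
        and xs: "\<forall>y\<in>set xs. y \<notin> set q'"
        using split_list_first_prop[of p "\<lambda>x. x \<in> set q'"] by blast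
      obtain zs ws where qd: "q' = zs @ x # ws" using split_list[OF xq] by blast
      define r where "r = u # xs @ x # rev zs"
      have sp: "successively (\<lambda>x y. {x, y} \<in> E) p" "successively (\<lambda>x y. {x, y} \<in> E) q'"
        using p1(4) q1(3) by (auto simp: is_path_def)
      have "is_cycle V E r"
        unfolding is_cycle_def
      proof (intro conjI)
        \<comment> \<open>If \<open>xs\<close> and \<open>zs\<close> were both empty,
          \<open>hd p\<close> and \<open>hd q'\<close> would both be \<open>x\<close>.\<close>
        show "length r \<ge> 3" using hd_ne pd qd by (cases xs; cases zs) (auto simp: r_def)
        show "distinct r"
          using p1(2,4) q1(1,3) xs unfolding r_def pd qd by (auto simp: is_path_def)
        show "set r \<subseteq> V" using p1 q1 unfolding r_def pd qd by (auto simp: is_path_def)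
        have comm: "(\<lambda>x y. {y, x} \<in> E) = (\<lambda>x y. {x, y} \<in> E)" by (simp add: insert_commute)
        have A: "successively (\<lambda>x y. {x, y} \<in> E) (u # xs @ [x])"
          using sp(1) p1(3) unfolding pd
          by (cases xs) (auto simp: successively_append_iff successively_Cons hd_append split: if_splits)
        have B: "successively (\<lambda>x y. {x, y} \<in> E) (x # rev zs)"
          using sp(2) comm unfolding qd
          by (auto simp: successively_append_iff successively_Cons insert_commute hd_rev)
        have "successively (\<lambda>x y. {x, y} \<in> E) ((u # xs @ [x]) @ rev zs)"
          by (subst successively_append_iff, cases zs rule: rev_cases) (use A B in auto)
        then show "successively (\<lambda>x y. {x, y} \<in> E) r" by (simp add: r_def)
        show "{last r, hd r} \<in> E"
          using q1(2) unfolding r_def qd by (cases zs) (auto simp: insert_commute)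
      qed
      then show ?thesis using acyc by blast
    qed
  qed
qed

section \<open>Counting in trees of bounded degree\<close>

locale bounded_tree =
  fixes V :: "'v set" and E k
  assumes tree: "is_tree V E" and degree_le: "\<And>v. v \<in> V \<Longrightarrow> vertex_degree E v \<le> k"
begin

lemma finite_V: "finite V" and edge_subset: "e \<in> E \<Longrightarrow> e \<subseteq> V" and card_edge: "e \<in> E \<Longrightarrow> card e = 2"
  using tree by (auto simp: is_tree_def simple_graph_def)

lemma finite_E: "finite E"
  using finite_V edge_subset by (meson PowI finite_Pow_iff rev_finite_subset subsetI)

lemma is_path_tree_path: 
  assumes "u \<in> V" "v \<in> V" 
  shows "is_path V E u (tree_path V E u v) v"
proof -
  obtain p where p: "is_path V E u p v" using tree assms unfolding is_tree_def by blast
  show ?thesis unfolding tree_path_def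
  proof (rule theI[where a = p])
    fix q assume "is_path V E u q v"
    then show "q = p" using is_path_unique p tree unfolding is_tree_def by metis
  qed (rule p)
qed

definition neighbours where "neighbours v = {w. {v, w} \<in> E}"

lemma
  assumes "v \<in> V"
  shows finite_neighbours: "finite (neighbours v)" and card_neighbours_le: "card (neighbours v) \<le> k"
proof -
  have inj: "inj_on (\<lambda>w. {v, w}) (neighbours v)" by (auto simp: inj_on_def doubleton_eq_iff)
  have sub: "(\<lambda>w. {v, w}) ` neighbours v \<subseteq> {e\<in>E. v \<in> e}" by (auto simp: neighbours_def)
  have fin: "finite {e\<in>E. v \<in> e}" using finite_E by simp
  show "finite (neighbours v)" using finite_imageD[OF finite_subset[OF sub fin] inj] .
  show "card (neighbours v) \<le> k"
    using card_inj_on_le[OF inj sub fin] degree_le[OF assms] by (simp add: vertex_degree_def)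
qed

text \<open>Asking only for some path, rather than for a value of \<open>tree_dist\<close>, lets an
  induction strip the first vertex without appeal to uniqueness. Paths are vertex lists, hence
  \<open>Suc j\<close>.\<close>

definition layer where "layer w j = {v\<in>V. \<exists>p. is_path V E v p w \<and> length p = Suc j}"

lemma card_layer_le: "card (layer w j) \<le> k ^ j"
proof (induction j)
  case 0
  have "layer w 0 \<subseteq> {w}" by (auto simp: layer_def is_path_def length_Suc_conv)
  then show ?case by (metis card_mono card_1_singleton_iff One_nat_def finite.emptyI finite_insert power_0)
next
  case (Suc j)
  have "layer w (Suc j) \<subseteq> (\<Union>v\<in>layer w j. neighbours v)"
  proof
    fix v assume "v \<in> layer w (Suc j)"
    then obtain p where p: "v \<in> V" "is_path V E v p w" "length p = Suc (Suc j)" by (auto simp: layer_def)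
    then obtain a q where q: "p = a # q" "length q = Suc j" by (auto simp: length_Suc_conv)
    then have "q \<noteq> []" by auto
    with p q have "{v, hd q} \<in> E" "is_path V E (hd q) q w" using is_path_Cons by metis+
    moreover have "hd q \<in> V" using \<open>{v, hd q} \<in> E\<close> edge_subset by auto
    ultimately show "v \<in> (\<Union>v\<in>layer w j. neighbours v)"
      using q(2) by (auto simp: layer_def neighbours_def insert_commute)
  qed
  moreover have fin: "finite (layer w j)" using finite_V by (auto simp: layer_def)
  moreover have "layer w j \<subseteq> V" by (auto simp: layer_def)
  ultimately have "card (layer w (Suc j)) \<le> card (\<Union>v\<in>layer w j. neighbours v)"
    using finite_neighbours by (intro card_mono) auto
  also have "\<dots> \<le> (\<Sum>v\<in>layer w j. card (neighbours v))" by (rule card_UN_le[OF fin])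
  also have "\<dots> \<le> (\<Sum>v\<in>layer w j. k)"
    using card_neighbours_le by (intro sum_mono) (auto simp: layer_def)
  also have "\<dots> \<le> k ^ Suc j" using Suc by simp
  finally show ?case .
qed

text \<open>At most \<open>k ^ j\<close> vertices have distance \<open>j\<close> from
  \<open>w\<close>, so a geometric series with ratio \<open>k * x\<close> dominates the sum.\<close>

lemma sum_power_tree_dist_le:
  fixes x :: real
  assumes "w \<in> V" "0 \<le> x" "real k * x < 1"
  shows "(\<Sum>v\<in>V. x ^ tree_dist V E v w) \<le> 1 / (1 - real k * x)"
proof -
  define J where "J = (\<lambda>v. tree_dist V E v w) ` V"
  have finJ: "finite J" using finite_V by (simp add: J_def)
  have "(\<Sum>v\<in>V. x ^ tree_dist V E v w) = (\<Sum>j\<in>J. \<Sum>v\<in>{v\<in>V. tree_dist V E v w = j}. x ^ tree_dist V E v w)"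
    using finite_V finJ by (intro sum.group[symmetric]) (auto simp: J_def)
  also have "\<dots> \<le> (\<Sum>j\<in>J. (real k * x) ^ j)"
  proof (rule sum_mono)
    fix j
    have "{v\<in>V. tree_dist V E v w = j} \<subseteq> layer w j"
    proof
      fix v assume v: "v \<in> {v\<in>V. tree_dist V E v w = j}"
      then have "is_path V E v (tree_path V E v w) w" using is_path_tree_path assms(1) by auto
      moreover from this v have "length (tree_path V E v w) = Suc j"
        by (cases "tree_path V E v w") (auto simp: tree_dist_def is_path_def)
      ultimately show "v \<in> layer w j" using v by (auto simp: layer_def)
    qed
    moreover have "finite (layer w j)" using finite_V by (auto simp: layer_def)
    ultimately have "card {v\<in>V. tree_dist V E v w = j} \<le> k ^ j"
      using card_mono card_layer_le le_trans by meson
    then have "real (card {v\<in>V. tree_dist V E v w = j}) \<le> real k ^ j"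
      by (metis of_nat_le_iff of_nat_power)
    then show "(\<Sum>v\<in>{v\<in>V. tree_dist V E v w = j}. x ^ tree_dist V E v w) \<le> (real k * x) ^ j"
      using assms(2) by (simp add: power_mult_distrib mult_right_mono)
  qed
  also have "\<dots> \<le> (\<Sum>j. (real k * x) ^ j)"
    using assms by (intro sum_le_suminf finJ summable_geometric) auto
  also have "\<dots> = 1 / (1 - real k * x)" using assms by (intro suminf_geometric) auto
  finally show ?thesis .
qed

text \<open>Exponential moment bound: every map in the ball has weight
  \<open>x ^ labeling_dist\<close> at least \<open>x powr d\<close>, and the total weight of all
  maps from \<open>L\<close> to \<open>V\<close>, injective or not, factorises over the
  labels.\<close>

lemma card_ball_le:
  fixes x :: real
  assumes "finite L" "MH ` L \<subseteq> V" "0 < x" "x \<le> 1" "real k * x < 1"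
  shows "real (card {M \<in> L \<rightarrow>\<^sub>E V. real (labeling_dist V E L M MH) \<le> d})
           \<le> x powr (- d) * (1 / (1 - real k * x)) ^ card L"
proof -
  let ?B = "{M \<in> L \<rightarrow>\<^sub>E V. real (labeling_dist V E L M MH) \<le> d}"
  have fin: "finite (L \<rightarrow>\<^sub>E V)" using assms(1) finite_V by (simp add: finite_PiE)
  have "real (card ?B) * x powr d = (\<Sum>M\<in>?B. x powr d)" by simp
  also have "\<dots> \<le> (\<Sum>M\<in>?B. x ^ labeling_dist V E L M MH)"
    using assms(3,4) by (intro sum_mono) (auto simp: powr_realpow[symmetric] intro!: powr_mono')
  also have "\<dots> \<le> (\<Sum>M\<in>L \<rightarrow>\<^sub>E V. x ^ labeling_dist V E L M MH)"
    using fin assms(3) by (intro sum_mono2) auto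
  also have "\<dots> = (\<Sum>M\<in>L \<rightarrow>\<^sub>E V. \<Prod>l\<in>L. x ^ tree_dist V E (M l) (MH l))"
    by (simp add: labeling_dist_def power_sum)
  also have "\<dots> = (\<Prod>l\<in>L. \<Sum>v\<in>V. x ^ tree_dist V E v (MH l))"
    using assms(1) finite_V by (subst prod_sum_PiE) auto
  also have "\<dots> \<le> (\<Prod>l\<in>L. 1 / (1 - real k * x))"
    using assms by (intro prod_mono conjI sum_power_tree_dist_le sum_nonneg) auto
  finally have "real (card ?B) \<le> (1 / (1 - real k * x)) ^ card L / x powr d"
    using assms(3) by (simp add: pos_le_divide_eq)
  then show ?thesis by (simp add: powr_minus divide_inverse mult.commute)
qed

text \<open>Every vertex lies on an edge, namely the first edge of a path to some other vertex, and
  an edge covers two vertices.\<close>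

lemma card_V_le: assumes "card V \<ge> 2" shows "card V \<le> 2 * card E"
proof -
  have "V \<subseteq> \<Union>E"
  proof
    fix v assume v: "v \<in> V"
    obtain w where w: "w \<in> V" "w \<noteq> v"
      using assms v finite_V by (metis card_le_Suc0_iff_eq not_less_eq_eq numeral_2_eq_2)
    then obtain p where p: "is_path V E v p w" using tree v unfolding is_tree_def by blast
    then obtain q where "p = v # q" "q \<noteq> []" using w by (cases p) (auto simp: is_path_def split: if_splits)
    then have "{v, hd q} \<in> E" using p is_path_Cons by metis
    then show "v \<in> \<Union>E" by blast
  qed
  moreover have "finite (\<Union>E)" using finite_E finite_V edge_subset by (meson Sup_least finite_subset)
  ultimately have "card V \<le> card (\<Union>E)" by (intro card_mono)
  also have "\<dots> \<le> (\<Sum>e\<in>E. card e)" using card_UN_le[OF finite_E, of id] by simp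
  also have "\<dots> = 2 * card E" using card_edge by simp
  finally show ?thesis .
qed

text \<open>Depends neither on the queried label nor on the true labeling, so a guess from this set
  reveals nothing about the evolver.\<close>

definition answers :: "'v \<Rightarrow> 'v set option set" where
  "answers u = insert None (Some ` {e\<in>E. u \<in> e})"

lemma finite_answers: "finite (answers u)" and answers_ne: "answers u \<noteq> {}"
  using finite_E by (auto simp: answers_def)

lemma card_answers: assumes "u \<in> V" shows "card (answers u) \<le> Suc k"
proof -
  have "card (answers u) \<le> Suc (card (Some ` {e\<in>E. u \<in> e}))"
    unfolding answers_def by (rule card_insert_le_m1) auto
  also have "card (Some ` {e\<in>E. u \<in> e}) = card {e\<in>E. u \<in> e}" by (intro card_image) auto
  finally show ?thesis using degree_le[OF assms] by (simp add: vertex_degree_def)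
qed

lemma path_oracle_answers:
  assumes "u \<in> V" "MT l \<in> V"
  shows "path_oracle V E MT l u \<in> answers u"
proof (cases "MT l = u")
  case False
  have p: "is_path V E u (tree_path V E u (MT l)) (MT l)" using is_path_tree_path assms by simp
  then obtain a q where q: "tree_path V E u (MT l) = a # q" "q \<noteq> []"
    using False by (cases "tree_path V E u (MT l)") (auto simp: is_path_def split: if_splits)
  then have "{u, hd q} \<in> E" using p is_path_Cons by metis
  then show ?thesis using False q by (auto simp: path_oracle_def answers_def hd_conv_nth)
qed (simp add: path_oracle_def answers_def)

end

section \<open>Fresh and stale edges in a list of swaps\<close>

text \<open>Lists of swaps have the most recent swap at the head. An edge is fresh if it is disjoint from
  all edges swapped before it; every other entry of the list can be specified, given the earlier
  ones, in only \<open>O(k m)\<close> ways.\<close>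

primrec fresh_edges :: "'v set list \<Rightarrow> 'v set set" where
  "fresh_edges [] = {}"
| "fresh_edges (x # xs) =
     (if \<forall>y\<in>set xs. x \<inter> y = {} then insert x (fresh_edges xs) else fresh_edges xs)"

text \<open>A list rather than a set, so that repeated swaps count with multiplicity. A repetition
  of a fresh edge is itself stale.\<close>

primrec stale_edges :: "'v set list \<Rightarrow> 'v set list" where
  "stale_edges [] = []"
| "stale_edges (x # xs) =
     (if \<forall>y\<in>set xs. x \<inter> y = {} then stale_edges xs else x # stale_edges xs)"

lemma set_fresh_stale: "set es = fresh_edges es \<union> set (stale_edges es)"
  by (induction es) auto

lemma finite_fresh_edges: "finite (fresh_edges es)"
  by (induction es) auto

lemma fresh_edges_subset: "fresh_edges es \<subseteq> set es"
  using set_fresh_stale by blast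

lemma fresh_edges_disjoint:
  "e \<in> fresh_edges es \<Longrightarrow> f \<in> fresh_edges es \<Longrightarrow> e \<noteq> f \<Longrightarrow> e \<inter> f = {}"
  using fresh_edges_subset by (induction es) (fastforce split: if_splits)+

text \<open>The empty set must be excluded: it is disjoint from itself, so two occurrences of it
  would pass as fresh but count once.\<close>

lemma card_fresh_edges:
  "{} \<notin> set es \<Longrightarrow> card (fresh_edges es) + length (stale_edges es) = length es"
proof (induction es)
  case (Cons x xs)
  have "x \<notin> fresh_edges xs" if "\<forall>y\<in>set xs. x \<inter> y = {}"
    using that Cons.prems fresh_edges_subset by fastforce
  moreover have "card (fresh_edges xs) + length (stale_edges xs) = length xs" using Cons by simp
  ultimately show ?case by (simp add: finite_fresh_edges)
qed simp

lemma swap_along_notin: "M l \<notin> e \<Longrightarrow> swap_along e M l = M l"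
  by (simp add: swap_along_def)

lemma swap_along_in: assumes "card e = 2" "M l \<in> e" shows "e = {M l, swap_along e M l}"
proof -
  obtain a b where ab: "e = {a, b}" "a \<noteq> b" using assms(1) by (auto simp: card_2_iff)
  then show ?thesis using assms(2)
    by (auto simp: ab swap_along_doubleton Transposition.transpose_def)
qed

lemma foldr_swap_along_untouched:
  "\<forall>y\<in>set es. M l \<notin> y \<Longrightarrow> foldr swap_along es M l = M l"
  by (induction es) (auto simp: swap_along_notin)

text \<open>Freshness rules out earlier swaps at the endpoints of \<open>e\<close>. A later swap
  meeting \<open>e\<close>, a repetition of \<open>e\<close> included, would be stale, which the
  hypothesis forbids. So a label starting at one end of \<open>e\<close> finishes at the
  other.\<close>

lemma foldr_swap_along_isolated:
  assumes "\<forall>y\<in>set es. card y = 2" "e \<in> fresh_edges es" "\<forall>y\<in>set (stale_edges es). e \<inter> y = {}" "M l \<in> e"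
  shows "e = {M l, foldr swap_along es M l}"
  using assms
proof (induction es)
  case (Cons x xs)
  show ?case
  proof (cases "e = x \<and> (\<forall>y\<in>set xs. x \<inter> y = {})")
    case True
    then have "foldr swap_along xs M l = M l"
      using Cons.prems(4) by (intro foldr_swap_along_untouched) auto
    then show ?thesis using swap_along_in[of e "foldr swap_along xs M" l] True Cons.prems by auto
  next
    case False
    then have e: "e \<in> fresh_edges xs" using Cons.prems(2) by (auto split: if_splits)
    then have "e \<in> set xs" using fresh_edges_subset by auto
    then have disj: "e \<inter> x = {}" using Cons.prems(3) by (auto split: if_splits)
    have IH: "e = {M l, foldr swap_along xs M l}"
      using Cons.IH Cons.prems e by (auto split: if_splits)
    then have "foldr swap_along xs M l \<notin> x" using disj by auto
    then show ?thesis using IH by (simp add: swap_along_notin)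
  qed
qed simp

text \<open>A fresh edge that no stale edge meets is swapped exactly once and in isolation, so it can be
  read off from the resulting labeling. The fresh edges are pairwise disjoint, so each stale edge
  meets at most two of them.\<close>

lemma card_fresh_edges_diff_le:
  assumes card2: "\<forall>y\<in>set es. card y = 2"
    and X: "\<And>e. e \<in> set es \<Longrightarrow> \<exists>l\<in>L. e = {M l, foldr swap_along es M l} \<Longrightarrow> e \<in> X"
    and surj: "\<Union>(set es) \<subseteq> M ` L"
  shows "3 * card (fresh_edges es - X) \<le> 2 * length es"
proof -
  let ?F = "fresh_edges es"
  have "?F - X \<subseteq> (\<Union>y\<in>set (stale_edges es). {e\<in>?F. e \<inter> y \<noteq> {}})"
  proof
    fix e assume e: "e \<in> ?F - X"
    then have es: "e \<in> set es" using fresh_edges_subset by auto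
    then have "e \<noteq> {}" using card2 by fastforce
    then obtain l where "l \<in> L" "M l \<in> e" using surj es by blast
    then have "\<exists>y\<in>set (stale_edges es). e \<inter> y \<noteq> {}"
      using foldr_swap_along_isolated[OF card2, of e M l] X[OF es] e by blast
    then show "e \<in> (\<Union>y\<in>set (stale_edges es). {e\<in>?F. e \<inter> y \<noteq> {}})" using e by blast
  qed
  then have "card (?F - X) \<le> card (\<Union>y\<in>set (stale_edges es). {e\<in>?F. e \<inter> y \<noteq> {}})"
    by (rule card_mono[rotated]) (simp add: finite_fresh_edges)
  also have "\<dots> \<le> (\<Sum>y\<in>set (stale_edges es). card {e\<in>?F. e \<inter> y \<noteq> {}})"
    by (rule card_UN_le) simp
  also have "\<dots> \<le> (\<Sum>y\<in>set (stale_edges es). 2)"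
  proof (rule sum_mono)
    fix y assume "y \<in> set (stale_edges es)"
    then have "y \<in> set es" using set_fresh_stale[of es] by simp
    then have y: "card y = 2" using card2 by simp
    define g where "g = (\<lambda>e. SOME v. v \<in> e \<inter> y)"
    have g: "g e \<in> e \<inter> y" if "e \<inter> y \<noteq> {}" for e
      unfolding g_def using that someI_ex[of "\<lambda>v. v \<in> e \<inter> y"] by blast
    have "inj_on g {e\<in>?F. e \<inter> y \<noteq> {}}"
    proof (rule inj_onI)
      fix e f assume "e \<in> {e\<in>?F. e \<inter> y \<noteq> {}}" "f \<in> {e\<in>?F. e \<inter> y \<noteq> {}}" "g e = g f"
      then have "e \<in> ?F" "f \<in> ?F" "g e \<in> e \<inter> f" using g[of e] g[of f] by simp_all
      then show "e = f" using fresh_edges_disjoint[of e es f] by blast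
    qed
    moreover have "g ` {e\<in>?F. e \<inter> y \<noteq> {}} \<subseteq> y" using g by blast
    moreover have "finite y" using y by (intro card_ge_0_finite) simp
    ultimately show "card {e\<in>?F. e \<inter> y \<noteq> {}} \<le> 2" using card_inj_on_le[of g _ y] y by simp
  qed
  also have "\<dots> \<le> 2 * length (stale_edges es)" using card_length by auto
  finally have 1: "card (?F - X) \<le> 2 * length (stale_edges es)" .
  have "{} \<notin> set es" using card2 by fastforce
  then have "card ?F + length (stale_edges es) = length es" by (rule card_fresh_edges)
  moreover have "card (?F - X) \<le> card ?F" using finite_fresh_edges by (intro card_mono) auto
  \<comment> \<open>Add \<open>1\<close> to twice the bound
    \<open>card (?F - X) \<le> length es - length (stale_edges es)\<close>.\<close>
  ultimately show ?thesis using 1 by linarith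
qed

text \<open>Only labels that start at an endpoint of a swapped edge can move.\<close>

lemma card_moved_le:
  assumes "finite L" "inj_on M L" "\<forall>y\<in>set es. card y = 2"
  shows "card {l\<in>L. foldr swap_along es M l \<noteq> M l} \<le> 2 * length es"
proof -
  let ?S = "{l\<in>L. foldr swap_along es M l \<noteq> M l}"
  have fin: "finite y" if "y \<in> set es" for y
    using that assms(3) by (intro card_ge_0_finite) simp
  have "M ` ?S \<subseteq> \<Union>(set es)"
  proof
    fix v assume "v \<in> M ` ?S"
    then obtain l where l: "v = M l" "foldr swap_along es M l \<noteq> M l" by auto
    then have "\<not> (\<forall>y\<in>set es. M l \<notin> y)" using foldr_swap_along_untouched[of es M l] by metis
    then show "v \<in> \<Union>(set es)" using l(1) by blast
  qed
  moreover have "inj_on M ?S" using assms(2) by (rule inj_on_subset) auto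
  ultimately have "card ?S \<le> card (\<Union>(set es))" using fin by (intro card_inj_on_le) auto
  also have "\<dots> \<le> (\<Sum>y\<in>set es. card y)" using card_UN_le[of "set es" id] by simp
  also have "\<dots> = 2 * card (set es)" using assms(3) by simp
  also have "\<dots> \<le> 2 * length es" using card_length by auto
  finally show ?thesis .
qed

section \<open>Probability that random swaps produce a given labeling\<close>

context bounded_tree
begin

lemma card_touching_le:
  assumes "set xs \<subseteq> E"
  shows "card {x\<in>E. \<exists>y\<in>set xs. x \<inter> y \<noteq> {}} \<le> 2 * k * length xs"
proof -
  have "{x\<in>E. \<exists>y\<in>set xs. x \<inter> y \<noteq> {}} \<subseteq> (\<Union>y\<in>set xs. \<Union>v\<in>y. {e\<in>E. v \<in> e})" by auto
  moreover have fin: "finite y" if "y \<in> set xs" for y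
    using that assms edge_subset finite_V by (meson finite_subset subsetD)
  ultimately have "card {x\<in>E. \<exists>y\<in>set xs. x \<inter> y \<noteq> {}} \<le> card (\<Union>y\<in>set xs. \<Union>v\<in>y. {e\<in>E. v \<in> e})"
    using finite_E by (intro card_mono) auto
  also have "\<dots> \<le> (\<Sum>y\<in>set xs. card (\<Union>v\<in>y. {e\<in>E. v \<in> e}))" by (rule card_UN_le) simp
  also have "\<dots> \<le> (\<Sum>y\<in>set xs. 2 * k)"
  proof (rule sum_mono)
    fix y assume y: "y \<in> set xs"
    have "card (\<Union>v\<in>y. {e\<in>E. v \<in> e}) \<le> (\<Sum>v\<in>y. card {e\<in>E. v \<in> e})"
      using fin[OF y] by (rule card_UN_le)
    also have "\<dots> \<le> (\<Sum>v\<in>y. k)"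
      using y assms edge_subset degree_le by (intro sum_mono) (auto simp: vertex_degree_def)
    also have "\<dots> = 2 * k" using y assms card_edge by auto
    finally show "card (\<Union>v\<in>y. {e\<in>E. v \<in> e}) \<le> 2 * k" .
  qed
  also have "\<dots> \<le> 2 * k * length xs" using card_length[of xs] by (simp add: mult.commute)
  finally show ?thesis .
qed

text \<open>A new edge \<open>x\<close> touches an earlier one (at most
  \<open>2 * k * length xs\<close> choices), or lies in \<open>X\<close>, or is a further fresh edge
  outside \<open>X\<close>, which multiplies the weight by \<open>z\<close>.\<close>

lemma sum_fresh_weight_le:
  fixes z :: real
  assumes "0 \<le> z" "z \<le> 1" "finite X" "set xs \<subseteq> E"
  shows "(\<Sum>x\<in>E. z ^ card (fresh_edges (x # xs) - X))
    \<le> z ^ card (fresh_edges xs - X) * (real (2 * k * length xs + card X) + z * card E)"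
proof -
  let ?w = "z ^ card (fresh_edges xs - X)" and ?T = "{x\<in>E. \<exists>y\<in>set xs. x \<inter> y \<noteq> {}}"
  have w: "0 \<le> ?w" using assms by simp
  have "z ^ card (fresh_edges (x # xs) - X) \<le> ?w * (indicator ?T x + indicator X x + z)"
    if x: "x \<in> E" for x
  proof (cases "x \<in> ?T \<or> x \<in> X")
    case True
    \<comment> \<open>The exponent is unchanged: \<open>x\<close> is not fresh, or it is removed
      together with \<open>X\<close>.\<close>
    then have "z ^ card (fresh_edges (x # xs) - X) = ?w * 1"
      using x by auto
    also have "\<dots> \<le> ?w * (indicator ?T x + indicator X x + z)"
      using True w assms by (intro mult_left_mono) (auto simp: indicator_def)
    finally show ?thesis .
  next
    case False
    then have disj: "\<forall>y\<in>set xs. x \<inter> y = {}" using x by auto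
    have "x \<noteq> {}" using card_edge[OF x] by auto
    then have "x \<notin> fresh_edges xs" using disj fresh_edges_subset by fastforce
    then have "card (fresh_edges (x # xs) - X) = Suc (card (fresh_edges xs - X))"
      using disj False finite_fresh_edges[of xs] by (simp add: insert_Diff_if)
    then show ?thesis using w assms by (simp add: algebra_simps indicator_def)
  qed
  then have "(\<Sum>x\<in>E. z ^ card (fresh_edges (x # xs) - X))
      \<le> (\<Sum>x\<in>E. ?w * (indicator ?T x + indicator X x + z))" by (rule sum_mono)
  also have "\<dots> = ?w * (real (card (E \<inter> ?T)) + real (card (E \<inter> X)) + z * card E)"
    using finite_E by (simp add: sum_distrib_left[symmetric] sum.distrib indicator_def sum.inter_restrict[symmetric] flip: sum.inter_filter) (simp add: Int_def)
  also have "\<dots> \<le> ?w * (real (2 * k * length xs + card X) + z * card E)"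
  proof -
    have "E \<inter> ?T = ?T" by auto
    then have "card (E \<inter> ?T) \<le> 2 * k * length xs" using card_touching_le[OF assms(4)] by simp
    moreover have "card (E \<inter> X) \<le> card X" using assms(3) by (intro card_mono) auto
    ultimately have "card (E \<inter> ?T) + card (E \<inter> X) \<le> 2 * k * length xs + card X" by (rule add_mono)
    then have "real (card (E \<inter> ?T)) + real (card (E \<inter> X)) \<le> real (2 * k * length xs + card X)"
      by (simp only: of_nat_add[symmetric] of_nat_le_iff)
    then show ?thesis using w by (intro mult_left_mono) auto
  qed
  finally show ?thesis .
qed

text \<open>Each draw costs at most a factor \<open>b\<close>. The fixed bound \<open>m\<close> on
  the number of earlier edges makes this factor the same for all draws.\<close>

lemma nn_integral_fresh_weight_le:
  fixes z b :: real
  assumes "0 \<le> z" "z \<le> 1" "finite X" "E \<noteq> {}" "j \<le> m"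
    and b: "real (2 * k * m + card X) / card E + z \<le> b"
  shows "(\<integral>\<^sup>+es. ennreal (z ^ card (fresh_edges es - X)) \<partial>replicate_pmf j (pmf_of_set E)) \<le> ennreal (b ^ j)"
  using \<open>j \<le> m\<close>
proof (induction j)
  case 0
  then show ?case by simp
next
  case (Suc j)
  have cE: "card E > 0" using assms(4) finite_E by (simp add: card_gt_0_iff)
  have b0: "0 \<le> b" using b assms(1) by (meson add_nonneg_nonneg divide_nonneg_nonneg of_nat_0_le_iff order_trans)
  \<comment> \<open>\<open>replicate_pmf\<close> draws the head first. Commuting the draws makes the
    head, which is the newest swap, the last draw, so that the older edges are fixed when it is
    averaged.\<close>
  have rep: "replicate_pmf (Suc j) (pmf_of_set E) =
     bind_pmf (replicate_pmf j (pmf_of_set E)) (\<lambda>xs. map_pmf (\<lambda>x. x # xs) (pmf_of_set E))"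
    by (simp add: map_pmf_def) (rule bind_commute_pmf)
  have "(\<integral>\<^sup>+es. ennreal (z ^ card (fresh_edges es - X)) \<partial>replicate_pmf (Suc j) (pmf_of_set E)) =
     (\<integral>\<^sup>+xs. \<integral>\<^sup>+x. ennreal (z ^ card (fresh_edges (x # xs) - X)) \<partial>pmf_of_set E \<partial>replicate_pmf j (pmf_of_set E))"
    unfolding rep by simp
  also have "\<dots> \<le> (\<integral>\<^sup>+xs. ennreal (z ^ card (fresh_edges xs - X)) * ennreal b \<partial>replicate_pmf j (pmf_of_set E))"
  proof (intro nn_integral_mono_AE, unfold AE_measure_pmf_iff, intro ballI)
    fix xs assume "xs \<in> set_pmf (replicate_pmf j (pmf_of_set E))"
    then have xs: "set xs \<subseteq> E" "length xs = j"
      using assms(4) finite_E by (auto simp: set_replicate_pmf lists_eq_set)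
    have "(\<integral>\<^sup>+x. ennreal (z ^ card (fresh_edges (x # xs) - X)) \<partial>pmf_of_set E)
       = ennreal ((\<Sum>x\<in>E. z ^ card (fresh_edges (x # xs) - X)) / card E)"
      using cE assms by (subst nn_integral_pmf_of_set)
        (simp_all add: finite_E sum_ennreal ennreal_of_nat_eq_real_of_nat divide_ennreal sum_nonneg del: fresh_edges.simps)
    also have "\<dots> \<le> ennreal (z ^ card (fresh_edges xs - X) * b)"
    proof (rule ennreal_leI)
      let ?w = "z ^ card (fresh_edges xs - X)"
      have "(\<Sum>x\<in>E. z ^ card (fresh_edges (x # xs) - X)) / card E
         \<le> ?w * (real (2 * k * length xs + card X) + z * card E) / card E"
        using sum_fresh_weight_le[OF assms(1-3) xs(1)] by (intro divide_right_mono) auto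
      also have "\<dots> = ?w * (real (2 * k * j + card X) / card E + z)"
        using cE xs by (simp add: field_simps)
      also have "\<dots> \<le> ?w * (real (2 * k * m + card X) / card E + z)"
        using assms(1) Suc.prems
        by (intro mult_left_mono add_right_mono divide_right_mono of_nat_mono add_mono) auto
      also have "\<dots> \<le> ?w * b" using b assms(1) by (intro mult_left_mono) auto
      finally show "(\<Sum>x\<in>E. z ^ card (fresh_edges (x # xs) - X)) / card E \<le> ?w * b" .
    qed
    also have "\<dots> = ennreal (z ^ card (fresh_edges xs - X)) * ennreal b"
      using assms(1) b0 by (intro ennreal_mult) auto
    finally show "(\<integral>\<^sup>+x. ennreal (z ^ card (fresh_edges (x # xs) - X)) \<partial>pmf_of_set E)
       \<le> ennreal (z ^ card (fresh_edges xs - X)) * ennreal b" .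
  qed
  also have "\<dots> = (\<integral>\<^sup>+xs. ennreal (z ^ card (fresh_edges xs - X)) \<partial>replicate_pmf j (pmf_of_set E)) * ennreal b"
    by (simp add: nn_integral_multc)
  also have "\<dots> \<le> ennreal (b ^ j) * ennreal b" using Suc by (intro mult_right_mono) auto
  also have "\<dots> = ennreal (b ^ Suc j)" using b0 by (simp add: ennreal_mult[symmetric] mult.commute)
  finally show ?case .
qed

text \<open>A Markov inequality. On the event at most \<open>2 * m / 3\<close> fresh edges lie
  outside \<open>X\<close>, so the weight with \<open>z = y ^ 3\<close> is at least
  \<open>y ^ (2 * m)\<close>. Its expectation is at most \<open>(2 * y ^ 3) ^ m\<close>, and
  dividing gives the bound.\<close>

lemma prob_swaps_eq_le:
  fixes y :: real
  assumes y: "0 < y" "y \<le> 1" and ne: "E \<noteq> {}" and bij: "bij_betw MT L V"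
    and m: "real ((2 * k + 2) * m) \<le> y ^ 3 * card E"
  shows "measure_pmf.prob (replicate_pmf m (pmf_of_set E)) {es. \<forall>l\<in>L. foldr swap_along es MT l = M l}
     \<le> (2 * y) ^ m"
proof -
  let ?P = "replicate_pmf m (pmf_of_set E)" and ?A = "{es. \<forall>l\<in>L. foldr swap_along es MT l = M l}"
  have finL: "finite L" using bij finite_V bij_betw_finite by blast
  have supp: "set es \<subseteq> E \<and> length es = m" if "es \<in> set_pmf ?P" for es
    using that ne finite_E by (auto simp: set_replicate_pmf lists_eq_set)
  \<comment> \<open>All edges that can be read off from \<open>MT\<close> and the target
    \<open>M\<close>; the swap list does not enter.\<close>
  define X where "X = (\<lambda>l. {MT l, M l}) ` {l\<in>L. M l \<noteq> MT l}"
  have finX: "finite X" using finL by (simp add: X_def)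
  have cE: "card E > 0" using ne finite_E by (simp add: card_gt_0_iff)
  show ?thesis
  \<comment> \<open>If some list of \<open>m\<close> swaps does produce \<open>M\<close>, that
    single list already shows that at most \<open>2 * m\<close> labels moved, which bounds
    \<open>card X\<close>.\<close>
  proof (cases "set_pmf ?P \<inter> ?A = {}")
    case True
    then have "measure_pmf.prob ?P ?A = 0" by (simp add: measure_pmf_zero_iff)
    then show ?thesis using y by simp
  next
    case False
    then obtain es where es: "es \<in> set_pmf ?P" "es \<in> ?A" by auto
    have "card X \<le> card {l\<in>L. M l \<noteq> MT l}" unfolding X_def using finL by (intro card_image_le) auto
    also have "{l\<in>L. M l \<noteq> MT l} = {l\<in>L. foldr swap_along es MT l \<noteq> MT l}" using es by auto
    also have "card \<dots> \<le> 2 * length es"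
      using supp[OF es(1)] card_edge by (intro card_moved_le finL bij_betw_imp_inj_on[OF bij]) auto
    finally have X2: "card X \<le> 2 * m" using supp[OF es(1)] by simp
    have "real (2 * k * m + card X) / card E \<le> real ((2 * k + 2) * m) / card E"
      using X2 by (intro divide_right_mono) (auto simp: algebra_simps)
    also have "\<dots> \<le> y ^ 3" using m cE by (simp add: divide_le_eq)
    finally have b: "real (2 * k * m + card X) / card E + y ^ 3 \<le> 2 * y ^ 3" by simp
    have w: "ennreal (y ^ (2 * m)) * indicator ?A es \<le> ennreal ((y ^ 3) ^ card (fresh_edges es - X))"
      if "es \<in> set_pmf ?P" for es
    proof (cases "es \<in> ?A")
      case True
      have card2: "\<forall>e\<in>set es. card e = 2" using supp[OF that] card_edge by blast
      have "3 * card (fresh_edges es - X) \<le> 2 * length es"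
      proof (rule card_fresh_edges_diff_le[where M = MT and L = L, OF card2])
        show "\<Union>(set es) \<subseteq> MT ` L"
          using supp[OF that] edge_subset bij by (auto simp: bij_betw_def)
      next
        fix e assume "e \<in> set es" "\<exists>l\<in>L. e = {MT l, foldr swap_along es MT l}"
        then obtain l where l: "l \<in> L" "e = {MT l, M l}" "card e = 2" using True card2 by auto
        then have "M l \<noteq> MT l" by auto
        then show "e \<in> X" using l by (auto simp: X_def)
      qed
      then have "y ^ (2 * m) \<le> (y ^ 3) ^ card (fresh_edges es - X)"
        using supp[OF that] y by (auto simp: power_mult[symmetric] intro!: power_decreasing)
      then show ?thesis using True by (simp add: ennreal_leI)
    qed simp
    have "ennreal (y ^ (2 * m) * measure_pmf.prob ?P ?A) = ennreal (y ^ (2 * m)) * emeasure ?P ?A"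
      using y by (simp add: ennreal_mult measure_pmf.emeasure_eq_measure)
    also have "\<dots> = (\<integral>\<^sup>+es. ennreal (y ^ (2 * m)) * indicator ?A es \<partial>?P)"
      by (simp add: nn_integral_cmult)
    also have "\<dots> \<le> (\<integral>\<^sup>+es. ennreal ((y ^ 3) ^ card (fresh_edges es - X)) \<partial>?P)"
      using w by (intro nn_integral_mono_AE) (simp add: AE_measure_pmf_iff)
    also have "\<dots> \<le> ennreal ((2 * y ^ 3) ^ m)"
      using y by (intro nn_integral_fresh_weight_le[OF _ _ finX ne order.refl b]) (auto simp: power_le_one)
    finally have "y ^ (2 * m) * measure_pmf.prob ?P ?A \<le> (2 * y ^ 3) ^ m"
      using y by (simp add: ennreal_le_iff)
    also have "\<dots> = y ^ (2 * m) * (2 * y) ^ m"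
      by (simp add: power_mult power_mult_distrib power2_eq_square power3_eq_cube)
    finally show ?thesis using y by simp
  qed
qed

end

text \<open>Fubini's theorem for two independent draws, read off from the commutation of
  binds.\<close>

lemma nn_integral_pmf_swap:
  "(\<integral>\<^sup>+x. \<integral>\<^sup>+y. f x y \<partial>measure_pmf q \<partial>measure_pmf p) = (\<integral>\<^sup>+y. \<integral>\<^sup>+x. f x y \<partial>measure_pmf p \<partial>measure_pmf q)"
proof -
  have "(\<integral>\<^sup>+x. \<integral>\<^sup>+y. f x y \<partial>measure_pmf q \<partial>measure_pmf p) =
     (\<integral>\<^sup>+z. case_prod f z \<partial>bind_pmf p (\<lambda>x. bind_pmf q (\<lambda>y. return_pmf (x, y))))" by simp
  also have "\<dots> = (\<integral>\<^sup>+y. \<integral>\<^sup>+x. f x y \<partial>measure_pmf p \<partial>measure_pmf q)"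
    by (subst bind_commute_pmf) simp
  finally show ?thesis .
qed

section \<open>The evolver over a window of time\<close>

primrec swap_count :: "real \<Rightarrow> nat \<Rightarrow> nat \<Rightarrow> nat" where
  "swap_count c s 0 = 0"
| "swap_count c s (Suc r) = swap_count c s r + (if swap_due c (s + r) then 1 else 0)"

lemma swap_count_le: "swap_count c s r \<le> r"
  by (induction r) auto

text \<open>For \<open>c \<ge> 1\<close> the floor grows by at most one per time unit, so the
  indicator of a due swap equals its increment and the sum telescopes.\<close>

lemma swap_count_eq:
  assumes "c \<ge> 1"
  shows "int (swap_count c s r) = \<lfloor>real (s + r) / c\<rfloor> - \<lfloor>real s / c\<rfloor>"
proof (induction r)
  case (Suc r)
  have "real (Suc (s + r)) / c \<le> real (s + r) / c + 1"
    using assms by (simp add: field_simps)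
  then have "\<lfloor>real (Suc (s + r)) / c\<rfloor> \<le> \<lfloor>real (s + r) / c\<rfloor> + 1" by linarith
  moreover have "\<lfloor>real (s + r) / c\<rfloor> \<le> \<lfloor>real (Suc (s + r)) / c\<rfloor>"
    using assms by (intro floor_mono divide_right_mono) auto
  ultimately show ?case using Suc by (auto simp: swap_due_def)
qed simp

text \<open>The two floors together lose less than one swap, worth \<open>c\<close> time
  units.\<close>

lemma swap_count_ge:
  assumes "c \<ge> 1"
  shows "c * real (swap_count c s r) \<ge> real r - c"
proof -
  have "real (s + r) / c = real s / c + real r / c" by (simp add: add_divide_distrib)
  then have "real (swap_count c s r) \<ge> real r / c - 1"
    using swap_count_eq[OF assms, of s r] by linarith
  then show ?thesis using assms by (simp add: field_simps)
qed

text \<open>The evolver ignores the hypothesis, so the true labeling is a Markov chain of its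
  own.\<close>

primrec evolve :: "'v set set \<Rightarrow> real \<Rightarrow> nat \<Rightarrow> nat \<Rightarrow> ('l \<Rightarrow> 'v) \<Rightarrow> ('l \<Rightarrow> 'v) pmf" where
  "evolve E c s 0 MT = return_pmf MT"
| "evolve E c s (Suc r) MT = bind_pmf (evolve E c s r MT) (evolver_step E c (s + r))"

text \<open>The times of the swaps are deterministic, so only the edges are random and their number
  is \<open>swap_count c s r\<close>.\<close>

lemma evolve_eq:
  fixes MT :: "'l \<Rightarrow> 'v"
  shows "evolve E c s r MT =
     map_pmf (\<lambda>es. foldr swap_along es MT) (replicate_pmf (swap_count c s r) (pmf_of_set E))"
proof (induction r)
  case (Suc r)
  show ?case
  proof (cases "swap_due c (s + r)")
    case True
    let ?P = "replicate_pmf (swap_count c s r) (pmf_of_set E)"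
    have "evolve E c s (Suc r) MT =
       bind_pmf ?P (\<lambda>es. bind_pmf (pmf_of_set E) (\<lambda>e. return_pmf (foldr swap_along (e # es) MT)))"
      using True Suc by (simp add: evolver_step_def bind_map_pmf map_pmf_def bind_assoc_pmf bind_return_pmf)
    also have "\<dots> = bind_pmf (pmf_of_set E) (\<lambda>e. bind_pmf ?P (\<lambda>es. return_pmf (foldr swap_along (e # es) MT)))"
      by (rule bind_commute_pmf)
    also have "\<dots> = map_pmf (\<lambda>es. foldr swap_along es MT) (replicate_pmf (swap_count c s (Suc r)) (pmf_of_set E))"
      using True by (simp add: map_pmf_def bind_assoc_pmf bind_return_pmf)
    finally show ?thesis .
  next
    case False
    then have "evolver_step E c (s + r) = (return_pmf :: ('l \<Rightarrow> 'v) \<Rightarrow> _)"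
      by (simp add: fun_eq_iff evolver_step_def)
    then show ?thesis using Suc False by (simp add: bind_return_pmf')
  qed
qed simp

section \<open>Replacing oracle answers by guesses\<close>

context bounded_tree
begin

text \<open>The blind algorithm replaces each oracle answer by a uniform guess among the at most \<open>k + 1\<close>
  possible ones, which makes it independent of the evolver at the cost of a factor \<open>k + 1\<close> per step.\<close>

definition blind_step ::
  "('l, 'v) algorithm \<Rightarrow> ('l \<Rightarrow> 'v) \<times> ('l, 'v) history \<Rightarrow> (('l \<Rightarrow> 'v) \<times> ('l, 'v) history) pmf" where
  "blind_step A = (\<lambda>(MH, h). bind_pmf (choose_query A h MH) (\<lambda>(l, u).
     bind_pmf (pmf_of_set (answers u)) (\<lambda>a.
     map_pmf (\<lambda>m. (case m of None \<Rightarrow> MH | Some v \<Rightarrow> MH(l := v), (l, u, a, m) # h))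
       (choose_move A h MH l u a))))"

primrec blind_run ::
  "('l, 'v) algorithm \<Rightarrow> nat \<Rightarrow> ('l \<Rightarrow> 'v) \<times> ('l, 'v) history \<Rightarrow> (('l \<Rightarrow> 'v) \<times> ('l, 'v) history) pmf" where
  "blind_run A 0 s = return_pmf s"
| "blind_run A (Suc r) s = bind_pmf (blind_run A r s) (blind_step A)"

text \<open>One value of a nonnegative function is at most the sum of all values. This is the source
  of the factor \<open>k + 1\<close> per step.\<close>

lemma le_card_answers_times_average:
  fixes g :: "'v set option \<Rightarrow> ennreal"
  assumes "u \<in> V" "a \<in> answers u"
  shows "g a \<le> of_nat (Suc k) * (\<integral>\<^sup>+a. g a \<partial>pmf_of_set (answers u))"
proof -
  have pos: "card (answers u) > 0" using finite_answers answers_ne by (simp add: card_gt_0_iff)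
  have "g a \<le> sum g (answers u)" using assms finite_answers by (intro member_le_sum) auto
  also have "\<dots> = of_nat (card (answers u)) * (sum g (answers u) / of_nat (card (answers u)))"
    using pos ennreal_mult_divide_eq[of "of_nat (card (answers u))" "sum g (answers u)"]
    by (simp add: ennreal_times_divide mult.commute)
  also have "\<dots> = of_nat (card (answers u)) * (\<integral>\<^sup>+a. g a \<partial>pmf_of_set (answers u))"
    using finite_answers answers_ne by (simp add: nn_integral_pmf_of_set)
  also have "\<dots> \<le> of_nat (Suc k) * (\<integral>\<^sup>+a. g a \<partial>pmf_of_set (answers u))"
    using card_answers[OF assms(1)] by (intro mult_right_mono of_nat_mono) auto
  finally show ?thesis .
qed

text \<open>The guess agrees with the true answer with probability at least
  \<open>1 / (k + 1)\<close>, and then both steps act alike. Stating this for an arbitrary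
  \<open>f\<close> allows iteration.\<close>

lemma algorithm_step_le_blind:
  assumes A: "A \<in> class_C V E L" and MT: "bij_betw MT L V" and MH: "MH ` L \<subseteq> V"
  shows "(\<integral>\<^sup>+s. f s \<partial>algorithm_step V E A (MT, MH, h))
    \<le> of_nat (Suc k) * (\<integral>\<^sup>+b. f (MT, b) \<partial>blind_step A (MH, h))"
proof -
  define g where "g = (\<lambda>l u a. \<integral>\<^sup>+m. f (MT, case m of None \<Rightarrow> MH | Some v \<Rightarrow> MH(l := v), (l, u, a, m) # h)
     \<partial>choose_move A h MH l u a)"
  have "(\<integral>\<^sup>+s. f s \<partial>algorithm_step V E A (MT, MH, h)) =
      (\<integral>\<^sup>+q. (case q of (l, u) \<Rightarrow> g l u (path_oracle V E MT l u)) \<partial>choose_query A h MH)"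
    by (auto simp: algorithm_step_def g_def Let_def intro!: nn_integral_cong split: prod.split)
  also have "\<dots> \<le> (\<integral>\<^sup>+q. of_nat (Suc k) * (case q of (l, u) \<Rightarrow> \<integral>\<^sup>+a. g l u a \<partial>pmf_of_set (answers u)) \<partial>choose_query A h MH)"
  proof (intro nn_integral_mono_AE, unfold AE_measure_pmf_iff, intro ballI)
    fix q assume q: "q \<in> set_pmf (choose_query A h MH)"
    obtain l u where lu: "q = (l, u)" by (cases q)
    then have "l \<in> L" "u \<in> V" using q A MH by (auto simp: class_C_def)
    then have "path_oracle V E MT l u \<in> answers u"
      using MT by (intro path_oracle_answers) (auto simp: bij_betw_def)
    then show "(case q of (l, u) \<Rightarrow> g l u (path_oracle V E MT l u))
      \<le> of_nat (Suc k) * (case q of (l, u) \<Rightarrow> \<integral>\<^sup>+a. g l u a \<partial>pmf_of_set (answers u))"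
      using le_card_answers_times_average[OF \<open>u \<in> V\<close>] lu by simp
  qed
  also have "\<dots> = of_nat (Suc k) * (\<integral>\<^sup>+q. (case q of (l, u) \<Rightarrow> \<integral>\<^sup>+a. g l u a \<partial>pmf_of_set (answers u)) \<partial>choose_query A h MH)"
    by (rule nn_integral_cmult) simp
  also have "\<dots> = of_nat (Suc k) * (\<integral>\<^sup>+b. f (MT, b) \<partial>blind_step A (MH, h))"
    by (auto simp: blind_step_def g_def intro!: arg_cong2[where f = times] nn_integral_cong split: prod.split)
  finally show ?thesis .
qed

lemma swap_along_bij:
  assumes "e \<in> E" "bij_betw M L V"
  shows "bij_betw (swap_along e M) L V"
proof -
  obtain a b where ab: "e = {a, b}" "a \<noteq> b" using card_edge[OF assms(1)] by (auto simp: card_2_iff)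
  then have "a \<in> V" "b \<in> V" using edge_subset[OF assms(1)] by auto
  then have "bij_betw (Transposition.transpose a b) V V"
    by (intro permutes_imp_bij permutes_swap_id)
  then show ?thesis using assms(2) ab by (simp add: swap_along_doubleton bij_betw_trans)
qed

lemma foldr_swap_along_bij:
  "set es \<subseteq> E \<Longrightarrow> bij_betw M L V \<Longrightarrow> bij_betw (foldr swap_along es M) L V"
  by (induction es) (auto intro: swap_along_bij)

text \<open>\<open>class_C\<close> constrains the algorithm only at hypotheses with values in
  \<open>V\<close>, so this range condition has to be carried along the run.\<close>

lemma run_valid:
  assumes "E \<noteq> {}" "A \<in> class_C V E L" "bij_betw MT0 L V" "MH0 ` L \<subseteq> V"
  shows "(MT, MH, h) \<in> set_pmf (run V E c A MT0 MH0 t) \<Longrightarrow> bij_betw MT L V \<and> MH ` L \<subseteq> V"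
proof (induction t arbitrary: MT MH h)
  case (Suc t)
  then obtain MT1 MH1 h1 where s1: "(MT1, MH1, h1) \<in> set_pmf (run V E c A MT0 MH0 t)"
    "(MT, MH, h) \<in> set_pmf (time_step V E c A t (MT1, MH1, h1))" by auto
  then have IH: "bij_betw MT1 L V" "MH1 ` L \<subseteq> V" using Suc.IH by blast+
  obtain MT2 where MT2: "MT2 \<in> set_pmf (evolver_step E c t MT1)"
    "(MT, MH, h) \<in> set_pmf (algorithm_step V E A (MT2, MH1, h1))"
    using s1(2) by (auto simp: time_step_def)
  have "bij_betw MT2 L V"
    using MT2(1) IH(1) swap_along_bij assms(1) finite_E
    by (auto simp: evolver_step_def split: if_splits)
  moreover obtain l u m where lum: "(l, u) \<in> set_pmf (choose_query A h1 MH1)"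
     "m \<in> set_pmf (choose_move A h1 MH1 l u (path_oracle V E MT2 l u))"
     "MT = MT2" "MH = (case m of None \<Rightarrow> MH1 | Some v \<Rightarrow> MH1(l := v))"
    using MT2(2) by (auto simp: algorithm_step_def Let_def)
  moreover have "MH ` L \<subseteq> V"
  proof (cases m)
    case None
    then show ?thesis using lum IH by simp
  next
    case (Some v)
    have "l \<in> L" "u \<in> V" using lum(1) assms(2) IH(2) by (auto simp: class_C_def)
    then have "{MH1 l, v} \<in> E" using lum(2) assms(2) IH(2) Some by (auto simp: class_C_def)
    then have "v \<in> V" using edge_subset by blast
    then show ?thesis using lum(4) Some IH(2) by auto
  qed
  ultimately show ?case by simp
qed (use assms in simp)

text \<open>Given the state at time \<open>t\<close>, the blind hypothesis and the true labeling
  evolve independently, hence the two separate inner integrals.\<close>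

lemma run_le_blind:
  fixes A :: "('l, 'v) algorithm"
  assumes "E \<noteq> {}" "A \<in> class_C V E L" "bij_betw MT0 L V" "MH0 ` L \<subseteq> V"
  shows "(\<integral>\<^sup>+s. f s \<partial>run V E c A MT0 MH0 (t + r))
    \<le> of_nat (Suc k) ^ r * (\<integral>\<^sup>+(MT, b). \<integral>\<^sup>+b'. \<integral>\<^sup>+MT'. f (MT', b')
        \<partial>evolve E c t r MT \<partial>blind_run A r b \<partial>run V E c A MT0 MH0 t)"
proof (induction r arbitrary: f)
  case 0
  show ?case by (simp add: case_prod_unfold)
next
  case (Suc r)
  let ?K = "of_nat (Suc k) :: ennreal" and ?R = "run V E c A MT0 MH0"
  \<comment> \<open>The final time unit with a blind step, as a function of the state before it. The
    induction hypothesis is applied to \<open>g\<close> in place of \<open>f\<close>.\<close>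
  define g where "g = (\<lambda>(MT, b). \<integral>\<^sup>+MT'. \<integral>\<^sup>+b'. f (MT', b') \<partial>blind_step A b \<partial>evolver_step E c (t + r) MT)"
  have "(\<integral>\<^sup>+s. f s \<partial>?R (t + Suc r)) = (\<integral>\<^sup>+s. \<integral>\<^sup>+s'. f s' \<partial>time_step V E c A (t + r) s \<partial>?R (t + r))"
    by simp
  also have "\<dots> \<le> (\<integral>\<^sup>+s. ?K * g s \<partial>?R (t + r))"
  proof (intro nn_integral_mono_AE, unfold AE_measure_pmf_iff, intro ballI)
    fix s assume s: "s \<in> set_pmf (?R (t + r))"
    obtain MT MH h where [simp]: "s = (MT, MH, h)" by (cases s)
    have v: "bij_betw MT L V" "MH ` L \<subseteq> V" using run_valid[OF assms] s by auto
    have "(\<integral>\<^sup>+s'. f s' \<partial>time_step V E c A (t + r) s) =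
      (\<integral>\<^sup>+MT'. \<integral>\<^sup>+s'. f s' \<partial>algorithm_step V E A (MT', MH, h) \<partial>evolver_step E c (t + r) MT)"
      by (simp add: time_step_def)
    also have "\<dots> \<le> (\<integral>\<^sup>+MT'. ?K * (\<integral>\<^sup>+b'. f (MT', b') \<partial>blind_step A (MH, h)) \<partial>evolver_step E c (t + r) MT)"
    proof (intro nn_integral_mono_AE, unfold AE_measure_pmf_iff, intro ballI)
      fix MT' assume "MT' \<in> set_pmf (evolver_step E c (t + r) MT)"
      then have "bij_betw MT' L V" using v(1) swap_along_bij assms(1) finite_E
        by (auto simp: evolver_step_def split: if_splits)
      then show "(\<integral>\<^sup>+s'. f s' \<partial>algorithm_step V E A (MT', MH, h)) \<le> ?K * (\<integral>\<^sup>+b'. f (MT', b') \<partial>blind_step A (MH, h))"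
        using assms(2) v(2) by (intro algorithm_step_le_blind)
    qed
    also have "\<dots> = ?K * g s" by (subst nn_integral_cmult) (simp_all add: g_def)
    finally show "(\<integral>\<^sup>+s'. f s' \<partial>time_step V E c A (t + r) s) \<le> ?K * g s" .
  qed
  also have "\<dots> = ?K * (\<integral>\<^sup>+s. g s \<partial>?R (t + r))" by (rule nn_integral_cmult) simp
  also have "\<dots> \<le> ?K * (?K ^ r * (\<integral>\<^sup>+(MT, b). \<integral>\<^sup>+b'. \<integral>\<^sup>+MT'. g (MT', b')
        \<partial>evolve E c t r MT \<partial>blind_run A r b \<partial>?R t))"
    by (intro mult_left_mono Suc.IH) simp
  also have "(\<lambda>(MT, b). \<integral>\<^sup>+b'. \<integral>\<^sup>+MT'. g (MT', b') \<partial>evolve E c t r MT \<partial>blind_run A r b) =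
     (\<lambda>(MT, b). \<integral>\<^sup>+b'. \<integral>\<^sup>+MT'. f (MT', b') \<partial>evolve E c t (Suc r) MT \<partial>blind_run A (Suc r) b)"
  \<comment> \<open>The last blind step does not see the last swap, so the two integrals can be
    exchanged.\<close>
  proof (intro ext, clarify)
    fix MT and b :: "('l \<Rightarrow> 'v) \<times> ('l, 'v) history"
    have "(\<integral>\<^sup>+MT'. g (MT', b') \<partial>evolve E c t r MT) =
       (\<integral>\<^sup>+b''. \<integral>\<^sup>+MT'. f (MT', b'') \<partial>evolve E c t (Suc r) MT \<partial>blind_step A b')" for b'
    proof -
      have "(\<integral>\<^sup>+MT'. g (MT', b') \<partial>evolve E c t r MT) =
        (\<integral>\<^sup>+MT'. \<integral>\<^sup>+b''. f (MT', b'') \<partial>blind_step A b' \<partial>evolve E c t (Suc r) MT)"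
        by (simp add: g_def)
      also have "\<dots> = (\<integral>\<^sup>+b''. \<integral>\<^sup>+MT'. f (MT', b'') \<partial>evolve E c t (Suc r) MT \<partial>blind_step A b')"
        by (rule nn_integral_pmf_swap)
      finally show ?thesis .
    qed
    then show "(\<integral>\<^sup>+b'. \<integral>\<^sup>+MT'. g (MT', b') \<partial>evolve E c t r MT \<partial>blind_run A r b) =
      (\<integral>\<^sup>+b'. \<integral>\<^sup>+MT'. f (MT', b') \<partial>evolve E c t (Suc r) MT \<partial>blind_run A (Suc r) b)"
      by simp
  qed
  finally show ?case by (simp add: mult.assoc)
qed

section \<open>Probability that the hypothesis is close to the true labeling\<close>

text \<open>Union bound over the ball around the fixed map \<open>MH\<close>: its size times the
  largest probability of a single labeling.\<close>

lemma prob_evolve_close_le: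
  fixes x y d :: real
  assumes ne: "E \<noteq> {}" and bij: "bij_betw MT L V" and MH: "MH ` L \<subseteq> V"
    and x: "0 < x" "x \<le> 1" "real k * x < 1" and y: "0 < y" "y \<le> 1"
    and m: "real ((2 * k + 2) * swap_count c s r) \<le> y ^ 3 * card E"
  shows "measure_pmf.prob (evolve E c s r MT) {M. real (labeling_dist V E L M MH) \<le> d}
    \<le> x powr (- d) * (1 / (1 - real k * x)) ^ card V * (2 * y) ^ swap_count c s r"
proof -
  let ?m = "swap_count c s r"
  let ?P = "replicate_pmf ?m (pmf_of_set E)"
  let ?B = "{M \<in> L \<rightarrow>\<^sub>E V. real (labeling_dist V E L M MH) \<le> d}"
  let ?A = "\<lambda>M. {es. \<forall>l\<in>L. foldr swap_along es MT l = M l}"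
  have finL: "finite L" using bij finite_V bij_betw_finite by blast
  have finB: "finite ?B" using finL finite_V by (intro finite_subset[OF _ finite_PiE]) auto
  have "measure_pmf.prob (evolve E c s r MT) {M. real (labeling_dist V E L M MH) \<le> d} =
     measure_pmf.prob ?P {es. real (labeling_dist V E L (foldr swap_along es MT) MH) \<le> d}"
    by (simp add: evolve_eq vimage_def)
  also have "\<dots> \<le> measure_pmf.prob ?P (\<Union>M\<in>?B. ?A M)"
  proof (rule measure_pmf.finite_measure_mono_AE)
    show "AE es in ?P. es \<in> {es. real (labeling_dist V E L (foldr swap_along es MT) MH) \<le> d} \<longrightarrow> es \<in> (\<Union>M\<in>?B. ?A M)"
      unfolding AE_measure_pmf_iff
    proof (intro ballI impI)
      fix es assume es: "es \<in> set_pmf ?P" "es \<in> {es. real (labeling_dist V E L (foldr swap_along es MT) MH) \<le> d}"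
      \<comment> \<open>The distance and the event \<open>?A\<close> only see labels in
        \<open>L\<close>; restricting lands in the finite set of extensional maps.\<close>
      let ?M = "restrict (foldr swap_along es MT) L"
      have "set es \<subseteq> E" using es(1) ne finite_E by (auto simp: set_replicate_pmf lists_eq_set)
      then have "bij_betw (foldr swap_along es MT) L V" using bij by (rule foldr_swap_along_bij)
      then have "?M \<in> L \<rightarrow>\<^sub>E V" by (auto dest: bij_betwE)
      then have "?M \<in> ?B" "es \<in> ?A ?M" using es(2) by (auto simp: labeling_dist_def)
      then show "es \<in> (\<Union>M\<in>?B. ?A M)" by blast
    qed
  qed simp
  also have "\<dots> \<le> (\<Sum>M\<in>?B. measure_pmf.prob ?P (?A M))"
    by (intro measure_pmf.finite_measure_subadditive_finite finB) auto
  also have "\<dots> \<le> (\<Sum>M\<in>?B. (2 * y) ^ ?m)"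
    by (intro sum_mono prob_swaps_eq_le y ne bij m)
  also have "\<dots> = real (card ?B) * (2 * y) ^ ?m" by simp
  also have "\<dots> \<le> x powr (- d) * (1 / (1 - real k * x)) ^ card L * (2 * y) ^ ?m"
    using y by (intro mult_right_mono card_ball_le finL MH x) auto
  finally show ?thesis using bij_betw_same_card[OF bij] by simp
qed

text \<open>Once the state at time \<open>t\<close> and the outcome of the blind run are fixed, so
  is the hypothesis, and the bound for a fixed map applies.\<close>

lemma prob_run_close_le:
  fixes A :: "('l, 'v) algorithm" and x y d :: real
  assumes ne: "E \<noteq> {}" and A: "A \<in> class_C V E L" and bij: "bij_betw MT0 L V" and MH: "MH0 ` L \<subseteq> V"
    and x: "0 < x" "x \<le> 1" "real k * x < 1" and y: "0 < y" "y \<le> 1"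
    and m: "real ((2 * k + 2) * swap_count c t r) \<le> y ^ 3 * card E"
  shows "measure_pmf.prob (distance_at V E L c A MT0 MH0 (t + r)) {n. real n \<le> d}
    \<le> real (Suc k) ^ r * (x powr (- d) * (1 / (1 - real k * x)) ^ card V * (2 * y) ^ swap_count c t r)"
proof -
  let ?b = "x powr (- d) * (1 / (1 - real k * x)) ^ card V * (2 * y) ^ swap_count c t r"
  \<comment> \<open>With the range condition inside the event, the integrand vanishes at blind
    outcomes that leave \<open>V\<close>. For the real run the condition holds by
    \<open>run_valid\<close>.\<close>
  define B where "B = {(MT, MH, h :: ('l, 'v) history). MH ` L \<subseteq> V \<and> real (labeling_dist V E L MT MH) \<le> d}"
  have b0: "0 \<le> ?b" using x y by simp
  have "measure_pmf.prob (distance_at V E L c A MT0 MH0 (t + r)) {n. real n \<le> d} =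
     measure_pmf.prob (run V E c A MT0 MH0 (t + r)) {(MT, MH, h). real (labeling_dist V E L MT MH) \<le> d}"
    by (simp add: distance_at_def vimage_def case_prod_unfold)
  also have "\<dots> \<le> measure_pmf.prob (run V E c A MT0 MH0 (t + r)) B"
    by (intro measure_pmf.finite_measure_mono_AE)
      (auto simp: AE_measure_pmf_iff B_def dest: run_valid[OF ne A bij MH])
  finally have 1: "measure_pmf.prob (distance_at V E L c A MT0 MH0 (t + r)) {n. real n \<le> d}
      \<le> measure_pmf.prob (run V E c A MT0 MH0 (t + r)) B" .
  have "ennreal (measure_pmf.prob (run V E c A MT0 MH0 (t + r)) B) =
      (\<integral>\<^sup>+s. indicator B s \<partial>run V E c A MT0 MH0 (t + r))"
    by (simp add: measure_pmf.emeasure_eq_measure)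
  also have "\<dots> \<le> of_nat (Suc k) ^ r * (\<integral>\<^sup>+(MT, b). \<integral>\<^sup>+b'. \<integral>\<^sup>+MT'. indicator B (MT', b')
        \<partial>evolve E c t r MT \<partial>blind_run A r b \<partial>run V E c A MT0 MH0 t)"
    by (rule run_le_blind[OF ne A bij MH])
  also have "\<dots> \<le> of_nat (Suc k) ^ r * (\<integral>\<^sup>+(MT, b). \<integral>\<^sup>+b'. ennreal ?b
        \<partial>blind_run A r b \<partial>run V E c A MT0 MH0 t)"
  proof (intro mult_left_mono nn_integral_mono_AE, unfold AE_measure_pmf_iff, intro ballI)
    fix s assume s: "s \<in> set_pmf (run V E c A MT0 MH0 t)"
    obtain MT MH1 h1 where s_eq: "s = (MT, MH1, h1)" by (cases s)
    then have MT: "bij_betw MT L V" using run_valid[OF ne A bij MH] s by auto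
    have "(\<integral>\<^sup>+MT'. indicator B (MT', b') \<partial>evolve E c t r MT) \<le> ennreal ?b" for b'
    proof -
      obtain MH' h' where b': "b' = (MH', h')" by (cases b')
      show ?thesis
      proof (cases "MH' ` L \<subseteq> V")
        case True
        have "(\<integral>\<^sup>+MT'. indicator B (MT', b') \<partial>evolve E c t r MT) =
           (\<integral>\<^sup>+MT'. indicator {M. real (labeling_dist V E L M MH') \<le> d} MT' \<partial>evolve E c t r MT)"
          using True by (intro nn_integral_cong) (auto simp: B_def b' indicator_def)
        also have "\<dots> = ennreal (measure_pmf.prob (evolve E c t r MT) {M. real (labeling_dist V E L M MH') \<le> d})"
          by (simp add: measure_pmf.emeasure_eq_measure)
        also have "\<dots> \<le> ennreal ?b"
          by (intro ennreal_leI prob_evolve_close_le ne MT True x y m)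
        finally show ?thesis .
      qed (simp add: B_def b')
    qed
    then show "(case s of (MT, b) \<Rightarrow> \<integral>\<^sup>+b'. \<integral>\<^sup>+MT'. indicator B (MT', b') \<partial>evolve E c t r MT \<partial>blind_run A r b)
      \<le> (case s of (MT, b) \<Rightarrow> \<integral>\<^sup>+b'. ennreal ?b \<partial>blind_run A r b)"
      unfolding s_eq prod.case by (intro nn_integral_mono)
  qed simp
  also have "\<dots> = ennreal (real (Suc k) ^ r * ?b)"
    using b0 by (simp add: case_prod_unfold ennreal_mult ennreal_power[symmetric] ennreal_of_nat_eq_real_of_nat del: of_nat_Suc)
  finally have "measure_pmf.prob (run V E c A MT0 MH0 (t + r)) B \<le> real (Suc k) ^ r * ?b"
    using b0 by (subst (asm) ennreal_le_iff) auto
  with 1 show ?thesis by linarith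
qed

end

section \<open>Choice of the constants and conclusion\<close>

theorem theorem3:
  fixes k :: nat and c :: real
  assumes "c \<ge> 1"
  shows "\<exists>\<alpha>>0. \<exists>\<beta>>0. \<exists>N::nat. \<exists>t0 :: nat \<Rightarrow> nat.
    \<forall>n\<ge>N. \<forall>(V :: 'v set) E (L :: 'l set) MT0 MH0 A.
      is_tree V E \<and> card V = n \<and> (\<forall>v\<in>V. vertex_degree E v \<le> k) \<and>
      bij_betw MT0 L V \<and> MH0 ` L \<subseteq> V \<and> A \<in> class_C V E L \<longrightarrow>
      (\<forall>t\<ge>t0 n.
        measure_pmf.prob (distance_at V E L c A MT0 MH0 t) {d. real d \<ge> \<alpha> * real n}
          \<ge> 1 - exp (- \<beta> * real n))"
proof -
  \<comment> \<open>The summand 3 leaves \<open>- 3 * W n\<close> in the final exponent. This pays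
    for the ball (\<open>w * n / 2\<close>), the boundary loss \<open>c * K\<close> and the final
    rate \<open>w * n\<close>.\<close>
  define K where "K = ln (real (Suc k)) + 3"
  define y where "y = exp (- (c * K)) / 2"
  \<comment> \<open>With \<open>m \<le> W n \<le> 2 * w * n\<close> and
    \<open>n \<le> 2 * card E\<close> this yields exactly the bound on \<open>m\<close> that
    \<open>prob_run_close_le\<close> requires.\<close>
  define w where "w = y ^ 3 / (4 * (2 * real k + 2))"
  \<comment> \<open>Makes \<open>k * x \<le> w / 8\<close>, so that the factor
    \<open>(1 / (1 - k * x)) ^ n\<close> is at most \<open>exp (w * n / 4)\<close>.\<close>
  define x where "x = w / (8 * (real k + 1))"
  \<comment> \<open>The window of \<open>W n\<close> steps contains about \<open>W n / c\<close> swaps. \<open>y\<close> is chosen so that their gain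
    \<open>(2 y)\<close> per swap beats \<open>(k + 1) e\<^sup>2\<close> per step; \<open>w\<close>, \<open>x\<close> and \<open>\<alpha>\<close> are then small in terms of \<open>y\<close>.\<close>
  define \<alpha> where "\<alpha> = w / (4 * (- ln x))"
  define W where "W = (\<lambda>n::nat. nat \<lceil>w * real n\<rceil>)"
  \<comment> \<open>Two vertices guarantee an edge. The other bound gives
    \<open>1 + c * K \<le> w * n\<close>, which absorbs both the ceiling in \<open>W n\<close> and
    the loss \<open>c * K\<close>.\<close>
  define N where "N = max 2 (nat \<lceil>(1 + c * K) / w\<rceil>)"
  have K: "K \<ge> 3" by (simp add: K_def)
  have cK: "c * K \<ge> 0" using assms K by simp
  have y: "0 < y" "y \<le> 1" "2 * y = exp (- (c * K))" 
    using order.trans[of "exp (- (c * K))" 1 2] cK by (auto simp: y_def)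
  have w: "0 < w" "w \<le> 1"
  proof -
    show "0 < w" using y by (simp add: w_def)
    have "y ^ 3 \<le> 1" using y by (intro power_le_one) auto
    then show "w \<le> 1" by (simp add: w_def divide_le_eq)
  qed
  have x: "0 < x" "x < 1" "real k * x \<le> w / 8"
    using w by (auto simp: x_def field_simps)
  have \<alpha>: "\<alpha> > 0" using x w by (simp add: \<alpha>_def divide_pos_neg)
  show ?thesis
  \<comment> \<open>The rate is \<open>w\<close> itself. From time \<open>W n\<close> on, a whole
    window fits before \<open>t\<close>.\<close>
  proof (rule exI[of _ \<alpha>], intro conjI \<alpha>, rule exI[of _ w], intro conjI w(1),
      rule exI[of _ N], rule exI[of _ W], intro allI impI)
    fix n and V :: "'v set" and E and L :: "'l set" and MT0 MH0 A t
    assume n: "N \<le> n" and t: "W n \<le> t"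
      and H: "is_tree V E \<and> card V = n \<and> (\<forall>v\<in>V. vertex_degree E v \<le> k) \<and>
        bij_betw MT0 L V \<and> MH0 ` L \<subseteq> V \<and> A \<in> class_C V E L"
    interpret bounded_tree V E k using H by unfold_locales auto
    define s where "s = t - W n"
    define m where "m = swap_count c s (W n)"
    have ts: "t = s + W n" using t by (simp add: s_def)
    have "(1 + c * K) / w \<le> real n" using n by (simp add: N_def)
    then have wn: "1 + c * K \<le> w * real n" using w by (simp add: divide_le_eq mult.commute)
    have W1: "w * real n \<le> real (W n)" unfolding W_def by (rule real_nat_ceiling_ge)
    have W2: "real (W n) \<le> 2 * (w * real n)" using wn cK unfolding W_def by linarith
    have n2: "n \<le> 2 * card E" "2 \<le> n" using card_V_le n H by (auto simp: N_def)
    then have ne: "E \<noteq> {}" by auto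
    have "real ((2 * k + 2) * m) = (2 * real k + 2) * real m"
      by (simp add: algebra_simps)
    also have "\<dots> \<le> (2 * real k + 2) * (2 * (w * real n))"
      using swap_count_le[of c s "W n"] W2 unfolding m_def by (intro mult_left_mono) linarith+
    also have "\<dots> = y ^ 3 * (real n / 2)" by (simp add: w_def field_simps)
    also have "\<dots> \<le> y ^ 3 * card E" using n2 y by (intro mult_left_mono) auto
    finally have m: "real ((2 * k + 2) * m) \<le> y ^ 3 * card E" .
    let ?D = "distance_at V E L c A MT0 MH0 t"
    let ?q = "real k * x"
    have q: "0 \<le> ?q" "?q \<le> 1 / 8" "?q < 1" using x w by auto
    have "measure_pmf.prob ?D {d. real d \<le> \<alpha> * n}
      \<le> real (Suc k) ^ W n * (x powr (- (\<alpha> * n)) * (1 / (1 - ?q)) ^ n * (2 * y) ^ m)"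
      using prob_run_close_le[OF ne, of A L MT0 MH0 x y c s "W n"] H x q y m
      unfolding ts m_def by simp
    also have "\<dots> \<le> exp (W n * (K - 3)) * (exp (w * n / 4) * exp (w * n / 4) * exp (c * K - W n * K))"
    proof (intro mult_mono)
      show "real (Suc k) ^ W n \<le> exp (W n * (K - 3))"
        by (simp add: K_def exp_of_nat_mult)
      \<comment> \<open>Both sides are equal by the choice of \<open>\<alpha>\<close>.\<close>
      show "x powr (- (\<alpha> * n)) \<le> exp (w * n / 4)"
        using x by (simp add: powr_def \<alpha>_def field_simps)
      have "1 / (1 - ?q) \<le> 1 + 2 * ?q"
      proof -
        have "1 \<le> (1 + 2 * ?q) * (1 - ?q)"
          using q mult_left_mono[of ?q "1/2" ?q] by (simp add: algebra_simps)
        then show ?thesis using q(3) by (simp add: divide_le_eq)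
      qed
      also have "\<dots> \<le> exp (2 * ?q)" by (rule exp_ge_add_one_self)
      also have "\<dots> \<le> exp (w / 4)" using x by simp
      finally have "(1 / (1 - ?q)) ^ n \<le> exp (w / 4) ^ n" using q by (intro power_mono) auto
      then show "(1 / (1 - ?q)) ^ n \<le> exp (w * n / 4)"
        by (simp add: exp_of_nat_mult[symmetric] mult.commute)
      have "(W n - c) * K \<le> c * real m * K"
        using swap_count_ge[OF assms, of "W n" s] K unfolding m_def by (intro mult_right_mono) auto
      then have "real m * (- (c * K)) \<le> c * K - W n * K" by (simp add: algebra_simps)
      then show "(2 * y) ^ m \<le> exp (c * K - W n * K)"
        unfolding y(3) exp_of_nat_mult[symmetric] by simp
    qed (use x y q in auto)
    also have "\<dots> = exp (W n * (K - 3) + (w * n / 4 + w * n / 4 + (c * K - W n * K)))"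
      by (simp only: exp_add)
    \<comment> \<open>The exponent collapses to \<open>c * K + w * n / 2 - 3 * W n\<close>, where
      \<open>c * K \<le> w * n - 1\<close> and \<open>W n \<ge> w * n\<close>.\<close>
    also have "\<dots> \<le> exp (- w * n)"
      using W1 wn by (simp add: algebra_simps)
    finally have le: "measure_pmf.prob ?D {d. real d \<le> \<alpha> * n} \<le> exp (- w * n)" .
    have "1 - measure_pmf.prob ?D {d. real d \<ge> \<alpha> * n} = measure_pmf.prob ?D (- {d. real d \<ge> \<alpha> * n})"
      using measure_pmf.prob_compl[of "{d. real d \<ge> \<alpha> * n}" ?D] by (simp add: Compl_eq_Diff_UNIV)
    also have "\<dots> \<le> measure_pmf.prob ?D {d. real d \<le> \<alpha> * n}"
      by (intro measure_pmf.finite_measure_mono) auto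
    finally show "1 - exp (- w * real n) \<le> measure_pmf.prob ?D {d. \<alpha> * real n \<le> real d}"
      using le by simp
  qed
qed

end
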